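(* Suppose $k \in \mathbb{N}$ and $\Gamma = (M; R)$ is a $k$-sparse graph and $G$ is a topological group which acts continuously (by automorphisms) on $\Gamma$. Suppose there are adjacent vertices $a, b$ in $\Gamma$ such that the $G_a$-orbit containing $b$ and the $G_b$-orbit containing $a$ are both infinite. Then $G$ is not amenable.
   Context: Graphs are undirected, without loops or multiple edges. A graph $(M;R)$ is $k$-sparse if for every finite $B \subseteq M$ the number of edges of the induced subgraph on $B$ is at most $k|B|$. A topological group $G$ acts continuously by automorphisms on $\Gamma$ if it acts by graph automorphisms and the action $G \times M \to M$ is continuous with $M$ discrete, i.e. stabilizers of vertices are open in $G$. $G_a = \{g \in G : ga = a\}$. A topological group $G$ is amenable if every $G$-flow (non-empty compact Hausdorff space with a continuous $G$-action) carries a $G$-invariant Borel probability measure. *)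

theory Defs
  imports "HOL-Probability.Probability" "HOL-Algebra.Group_Action"
begin

locale topological_group = group G for G (structure) +
  fixes T :: "'a topology"
  assumes topspace_eq_carrier: "topspace T = carrier G"
    and continuous_mult: "continuous_map (prod_topology T T) T (\<lambda>(x, y). x \<otimes> y)"
    and continuous_inv: "continuous_map T T (\<lambda>x. inv x)"

definition continuous_action ::
  "('a, 'c) monoid_scheme \<Rightarrow> 'a topology \<Rightarrow> 'x topology \<Rightarrow> ('a \<Rightarrow> 'x \<Rightarrow> 'x) \<Rightarrow> bool"
  where "continuous_action G T X \<phi> \<longleftrightarrow>
    group_action G (topspace X) \<phi> \<and>
    continuous_map (prod_topology T X) X (\<lambda>(g, x). \<phi> g x)"

definition flow ::
  "('a, 'c) monoid_scheme \<Rightarrow> 'a topology \<Rightarrow> 'x topology \<Rightarrow> ('a \<Rightarrow> 'x \<Rightarrow> 'x) \<Rightarrow> bool"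
  where "flow G T X \<phi> \<longleftrightarrow>
    topspace X \<noteq> {} \<and> compact_space X \<and> Hausdorff_space X \<and> continuous_action G T X \<phi>"

definition borel_of :: "'x topology \<Rightarrow> 'x measure"
  where "borel_of X = sigma (topspace X) {U. openin X U}"

definition invariant_borel_prob ::
  "('a, 'c) monoid_scheme \<Rightarrow> 'x topology \<Rightarrow> ('a \<Rightarrow> 'x \<Rightarrow> 'x) \<Rightarrow> 'x measure \<Rightarrow> bool"
  where "invariant_borel_prob G X \<phi> \<mu> \<longleftrightarrow>
    prob_space \<mu> \<and> space \<mu> = topspace X \<and> sets \<mu> = sets (borel_of X) \<and>
    (\<forall>g\<in>carrier G. \<forall>A\<in>sets \<mu>. emeasure \<mu> (\<phi> g ` A) = emeasure \<mu> A)"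

text \<open>
  HOL cannot quantify over all types inside a definition, so the flows below live on subsets
  of the fixed type \<open>'a set set\<close>. This is no restriction: every flow contains the closure
  of an orbit as a subflow, and that closure embeds into \<open>'a set set\<close>. The theorem
  \<open>amenable_imp_invariant_measure\<close> shows that \<open>amenable\<close> implies the property for flows
  over every type.
\<close>

definition amenable :: "('a, 'c) monoid_scheme \<Rightarrow> 'a topology \<Rightarrow> bool"
  where "amenable G T \<longleftrightarrow>
    (\<forall>(X :: 'a set set topology) \<phi>. flow G T X \<phi> \<longrightarrow> (\<exists>\<mu>. invariant_borel_prob G X \<phi> \<mu>))"

locale simple_graph =
  fixes M :: "'m set" and R :: "('m \<times> 'm) set"
  assumes rel: "R \<subseteq> M \<times> M"
    and symmetric: "sym R"
    and loopless: "irrefl R"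

text \<open>Edges are unordered pairs, so each edge is counted once although \<open>R\<close> is symmetric.\<close>

definition induced_edges :: "('m \<times> 'm) set \<Rightarrow> 'm set \<Rightarrow> 'm set set"
  where "induced_edges R B = {{x, y} |x y. x \<in> B \<and> y \<in> B \<and> (x, y) \<in> R}"

definition k_sparse :: "nat \<Rightarrow> 'm set \<Rightarrow> ('m \<times> 'm) set \<Rightarrow> bool"
  where "k_sparse k M R \<longleftrightarrow>
    (\<forall>B. B \<subseteq> M \<and> finite B \<longrightarrow> card (induced_edges R B) \<le> k * card B)"

definition acts_continuously_on_graph ::
  "('a, 'c) monoid_scheme \<Rightarrow> 'a topology \<Rightarrow> 'm set \<Rightarrow> ('m \<times> 'm) set \<Rightarrow> ('a \<Rightarrow> 'm \<Rightarrow> 'm) \<Rightarrow> bool"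
  where "acts_continuously_on_graph G T M R \<phi> \<longleftrightarrow>
    continuous_action G T (discrete_topology M) \<phi> \<and>
    (\<forall>g\<in>carrier G. \<forall>x\<in>M. \<forall>y\<in>M. (\<phi> g x, \<phi> g y) \<in> R \<longleftrightarrow> (x, y) \<in> R)"

section \<open>Independence of the choice of type in the definition of amenability\<close>

lemma space_borel_of [simp]: "space (borel_of X) = topspace X"
  unfolding borel_of_def by (rule space_measure_of) (auto dest: openin_subset)

lemma sets_borel_of: "sets (borel_of X) = sigma_sets (topspace X) {U. openin X U}"
  unfolding borel_of_def by (rule sets_measure_of) (auto dest: openin_subset)

lemma measurable_borel_of:
  assumes "continuous_map X Y f" "sets \<mu> = sets (borel_of X)" "sets \<nu> = sets (borel_of Y)"
  shows "f \<in> measurable \<mu> \<nu>"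
proof -
  have "f \<in> measurable (borel_of X) (borel_of Y)"
    unfolding borel_of_def[of Y]
  proof (rule measurable_measure_of)
    show "{U. openin Y U} \<subseteq> Pow (topspace Y)" by (auto dest: openin_subset)
    show "f \<in> space (borel_of X) \<rightarrow> topspace Y"
      using assms(1) by (auto simp: continuous_map_def)
    fix U assume "U \<in> {U. openin Y U}"
    then have "openin X {x \<in> topspace X. f x \<in> U}"
      using assms(1) by (auto simp: continuous_map_def)
    moreover have "f -` U \<inter> space (borel_of X) = {x \<in> topspace X. f x \<in> U}" by auto
    ultimately show "f -` U \<inter> space (borel_of X) \<in> sets (borel_of X)"
      by (auto simp: sets_borel_of)
  qed
  then show ?thesis using measurable_cong_sets[OF assms(2,3)] by simp
qed

lemma continuous_action_each:
  assumes "continuous_action G T X \<phi>" "topological_group G T" "g \<in> carrier G"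
  shows "continuous_map X X (\<phi> g)"
proof -
  have "continuous_map X (prod_topology T X) (\<lambda>x. (g, x))"
    using assms(2,3) by (auto simp: continuous_map_pairwise o_def topological_group.topspace_eq_carrier)
  then have "continuous_map X X ((\<lambda>(g, x). \<phi> g x) \<circ> (\<lambda>x. (g, x)))"
    using assms(1) continuous_map_compose unfolding continuous_action_def by blast
  then show ?thesis by (simp add: o_def)
qed

lemma group_actionI:
  assumes "group G"
    and closed: "\<And>g x. g \<in> carrier G \<Longrightarrow> x \<in> E \<Longrightarrow> \<phi> g x \<in> E"
    and ext: "\<And>g. g \<in> carrier G \<Longrightarrow> \<phi> g \<in> extensional E"
    and one: "\<And>x. x \<in> E \<Longrightarrow> \<phi> \<one>\<^bsub>G\<^esub> x = x"
    and mult: "\<And>g h x. g \<in> carrier G \<Longrightarrow> h \<in> carrier G \<Longrightarrow> x \<in> E \<Longrightarrow> \<phi> (g \<otimes>\<^bsub>G\<^esub> h) x = \<phi> g (\<phi> h x)"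
  shows "group_action G E \<phi>"
proof -
  interpret group G by fact
  have bij: "\<phi> g \<in> Bij E" if g: "g \<in> carrier G" for g
  proof -
    have "bij_betw (\<phi> g) E E"
    proof (rule bij_betw_byWitness[where f' = "\<phi> (inv\<^bsub>G\<^esub> g)"])
      show "\<forall>x\<in>E. \<phi> (inv\<^bsub>G\<^esub> g) (\<phi> g x) = x"
        using g by (metis inv_closed l_inv mult one)
      show "\<forall>x\<in>E. \<phi> g (\<phi> (inv\<^bsub>G\<^esub> g) x) = x"
        using g by (metis inv_closed r_inv mult one)
    qed (use g closed in auto)
    then show ?thesis using ext[OF g] by (simp add: Bij_def)
  qed
  have "\<phi> (g \<otimes>\<^bsub>G\<^esub> h) = compose E (\<phi> g) (\<phi> h)" if "g \<in> carrier G" "h \<in> carrier G" for g h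
    by (rule extensionalityI[of _ E]) (use that ext mult in \<open>auto simp: compose_eq\<close>)
  then have "\<phi> \<in> hom G (BijGroup E)"
    using bij by (auto simp: hom_def BijGroup_def)
  then show ?thesis
    using group_BijGroup assms(1) by (simp add: group_action_def group_hom_def group_hom_axioms_def)
qed

theorem amenable_imp_invariant_measure:
  fixes G :: "('a, 'c) monoid_scheme" (structure) and X :: "'x topology"
  assumes tg: "topological_group G T" and am: "amenable G T" and fl: "flow G T X \<phi>"
  shows "\<exists>\<mu>. invariant_borel_prob G X \<phi> \<mu>"
proof -
  interpret topological_group G T by fact
  have ca: "continuous_action G T X \<phi>" and Xne: "topspace X \<noteq> {}"
    and Xc: "compact_space X" and XH: "Hausdorff_space X"
    using fl by (auto simp: flow_def)
  interpret act: group_action G "topspace X" \<phi> using ca by (simp add: continuous_action_def)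
  obtain x0 where x0: "x0 \<in> topspace X" using Xne by blast
  have clos: "\<phi> g x \<in> topspace X" if "g \<in> carrier G" "x \<in> topspace X" for g x
    using act.element_image that by blast
  have cont: "continuous_map X X (\<phi> g)" if "g \<in> carrier G" for g
    using continuous_action_each[OF ca tg that] .
  have invl: "\<phi> (inv g) (\<phi> g x) = x" if "g \<in> carrier G" "x \<in> topspace X" for g x
    using act.orbit_sym_aux that by blast
  have invr: "\<phi> g (\<phi> (inv g) x) = x" if "g \<in> carrier G" "x \<in> topspace X" for g x
    using invl[of "inv g" x] that by simp
  define Ob where "Ob = (\<lambda>g. \<phi> g x0) ` carrier G"
  define Y where "Y = X closure_of Ob"
  have Ysub: "Y \<subseteq> topspace X" by (simp add: Y_def closure_of_subset_topspace)
  have Obsub: "Ob \<subseteq> topspace X" using clos x0 by (auto simp: Ob_def)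
  have Yne: "Y \<noteq> {}"
    using closure_of_subset[OF Obsub] by (auto simp: Y_def Ob_def)
  have Yinv: "\<phi> g y \<in> Y" if g: "g \<in> carrier G" and y: "y \<in> Y" for g y
  proof -
    have "\<phi> g ` Y \<subseteq> X closure_of (\<phi> g ` Ob)"
      unfolding Y_def using cont[OF g] by (rule continuous_map_image_closure_subset)
    moreover have "\<phi> g ` Ob \<subseteq> Ob"
      using g x0 by (auto simp: Ob_def act.composition_rule[symmetric])
    ultimately show ?thesis using y closure_of_mono unfolding Y_def by blast
  qed
  define i where "i y = {{g \<in> carrier G. \<phi> g x0 \<in> U} |U. openin X U \<and> y \<in> U}" for y
  have inj: "inj_on i Y"
  proof (rule inj_onI, rule ccontr)
    fix y z assume yz: "y \<in> Y" "z \<in> Y" "i y = i z" "y \<noteq> z"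
    then obtain U V where UV: "openin X U" "openin X V" "y \<in> U" "z \<in> V" "disjnt U V"
      using XH Ysub unfolding Hausdorff_space_def by (metis subsetD)
    have "{g \<in> carrier G. \<phi> g x0 \<in> U} \<in> i z"
      using yz(3) UV by (auto simp: i_def)
    then obtain W where W: "openin X W" "z \<in> W"
      "{g \<in> carrier G. \<phi> g x0 \<in> U} = {g \<in> carrier G. \<phi> g x0 \<in> W}"
      unfolding i_def by blast
    have "openin X (V \<inter> W)" "z \<in> V \<inter> W" using UV W by auto
    then obtain w where "w \<in> Ob" "w \<in> V \<inter> W"
      using yz(2) unfolding Y_def in_closure_of by blast
    then show False using UV(5) W(3) by (auto simp: Ob_def disjnt_def)
  qed
  define j where "j = inv_into Y i"
  have ji: "j (i y) = y" if "y \<in> Y" for y using inj that by (simp add: j_def)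
  define Z where "Z = pullback_topology (i ` Y) j X"
  have tZ: "topspace Z = i ` Y"
    using Ysub ji by (auto simp: Z_def topspace_pullback_topology)
  have jZ: "j z \<in> Y" "i (j z) = z" if "z \<in> topspace Z" for z
    using that ji by (auto simp: tZ)
  have cj: "continuous_map Z X j"
    using continuous_map_pullback[OF continuous_map_id, of "i ` Y" j X] by (simp add: Z_def)
  have homeo: "homeomorphic_maps (subtopology X Y) Z i j"
  proof -
    have "continuous_map (subtopology X Y) Z i"
      unfolding Z_def
    proof (rule continuous_map_pullback')
      show "continuous_map (subtopology X Y) X (j \<circ> i)"
        by (rule continuous_map_eq[of _ _ id]) (auto simp: ji continuous_map_from_subtopology)
    qed auto
    then show ?thesis
      using cj ji jZ Ysub
      by (auto simp: homeomorphic_maps_def continuous_map_in_subtopology)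
  qed
  then have hs: "subtopology X Y homeomorphic_space Z"
    unfolding homeomorphic_space_def by blast
  have "closedin X Y" by (simp add: Y_def)
  then have "compact_space (subtopology X Y)"
    using Xc closedin_compact_space compact_space_subtopology by blast
  then have Zc: "compact_space Z" using homeomorphic_compact_space[OF hs] by simp
  have ZH: "Hausdorff_space Z"
    using homeomorphic_Hausdorff_space[OF hs] Hausdorff_space_subtopology[OF XH] by simp
  define \<psi> where "\<psi> g = restrict (\<lambda>z. i (\<phi> g (j z))) (topspace Z)" for g
  have psi: "\<psi> g z = i (\<phi> g (j z))" if "z \<in> topspace Z" for g z
    using that by (simp add: \<psi>_def)
  have psi_clos: "\<psi> g z \<in> topspace Z" if "g \<in> carrier G" "z \<in> topspace Z" for g z
    using that Yinv jZ by (auto simp: psi) (auto simp: tZ)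
  have j_psi: "j (\<psi> g z) = \<phi> g (j z)" if "g \<in> carrier G" "z \<in> topspace Z" for g z
    using that Yinv jZ ji by (auto simp: psi)
  have "group_action G (topspace Z) \<psi>"
  proof (rule group_actionI)
    show "group G" by (rule group_axioms)
    show "\<psi> g \<in> extensional (topspace Z)" for g by (simp add: \<psi>_def)
    show "\<psi> \<one> z = z" if "z \<in> topspace Z" for z
    proof -
      have "j z \<in> topspace X" using jZ(1)[OF that] Ysub by blast
      then have "\<phi> \<one> (j z) = j z" using act.id_eq_one by (metis restrict_apply')
      then show ?thesis using that jZ by (simp add: psi)
    qed
    show "\<psi> (g \<otimes> h) z = \<psi> g (\<psi> h z)"
      if "g \<in> carrier G" "h \<in> carrier G" "z \<in> topspace Z" for g h z
    proof -
      have "j z \<in> topspace X" using jZ(1)[OF that(3)] Ysub by blast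
      then show ?thesis
        using that psi_clos j_psi act.composition_rule by (simp add: psi)
    qed
  qed (rule psi_clos)
  moreover have "continuous_map (prod_topology T Z) Z (\<lambda>(g, z). \<psi> g z)"
    unfolding Z_def
  proof (rule continuous_map_pullback', fold Z_def)
    have "continuous_map (prod_topology T Z) (prod_topology T X) (\<lambda>p. (fst p, (j \<circ> snd) p))"
      using continuous_map_compose[OF continuous_map_snd cj]
      by (intro continuous_map_pairedI continuous_map_fst)
    then have "continuous_map (prod_topology T Z) X
        ((\<lambda>(g, x). \<phi> g x) \<circ> (\<lambda>p. (fst p, (j \<circ> snd) p)))"
      using ca continuous_map_compose unfolding continuous_action_def by blast
    then show "continuous_map (prod_topology T Z) X (j \<circ> (\<lambda>(g, z). \<psi> g z))"
      by (rule continuous_map_eq) (auto simp: j_psi topspace_eq_carrier)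
    show "topspace (prod_topology T Z) \<subseteq> (\<lambda>(g, z). \<psi> g z) -` (i ` Y)"
      using psi_clos by (auto simp: topspace_eq_carrier simp flip: tZ)
  qed
  ultimately have "flow G T Z \<psi>"
    using Zc ZH Yne by (simp add: flow_def continuous_action_def tZ)
  then obtain \<mu> where mu: "invariant_borel_prob G Z \<psi> \<mu>"
    using am unfolding amenable_def by blast
  have pm: "prob_space \<mu>" and sp: "space \<mu> = topspace Z" and se: "sets \<mu> = sets (borel_of Z)"
    and inv: "\<And>g A. g \<in> carrier G \<Longrightarrow> A \<in> sets \<mu> \<Longrightarrow> emeasure \<mu> (\<psi> g ` A) = emeasure \<mu> A"
    using mu by (auto simp: invariant_borel_prob_def)
  have jm: "j \<in> measurable \<mu> (borel_of X)" using cj se by (rule measurable_borel_of) simp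
  define \<nu> where "\<nu> = distr \<mu> (borel_of X) j"
  have "emeasure \<nu> (\<phi> g ` A) = emeasure \<nu> A" if g: "g \<in> carrier G" and A: "A \<in> sets \<nu>" for g A
  proof -
    have A': "A \<in> sets (borel_of X)" using A by (simp add: \<nu>_def)
    have AX: "A \<subseteq> topspace X" using sets.sets_into_space[OF A'] by simp
    have eq: "\<phi> g ` A = \<phi> (inv g) -` A \<inter> space (borel_of X)"
    proof (intro equalityI subsetI)
      fix y assume "y \<in> \<phi> g ` A"
      then show "y \<in> \<phi> (inv g) -` A \<inter> space (borel_of X)"
        using g AX invl clos by auto
    next
      fix y assume y: "y \<in> \<phi> (inv g) -` A \<inter> space (borel_of X)"
      then have "y = \<phi> g (\<phi> (inv g) y)" using g invr by simp
      then show "y \<in> \<phi> g ` A" using y by blast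
    qed
    have "\<phi> (inv g) \<in> measurable (borel_of X) (borel_of X)"
      using cont[of "inv g"] g by (intro measurable_borel_of) auto
    then have gA: "\<phi> g ` A \<in> sets (borel_of X)"
      unfolding eq using A' by (rule measurable_sets)
    have "j -` (\<phi> g ` A) \<inter> space \<mu> = \<psi> g ` (j -` A \<inter> space \<mu>)"
    proof (intro equalityI subsetI)
      fix z assume z: "z \<in> j -` (\<phi> g ` A) \<inter> space \<mu>"
      then have zt: "z \<in> topspace Z" by (simp add: sp)
      have jzX: "j z \<in> topspace X" using jZ(1)[OF zt] Ysub by blast
      have "z = \<psi> g (\<psi> (inv g) z)"
        using g zt psi_clos[of "inv g" z] j_psi[of "inv g" z] invr[OF g jzX] jZ(2)[OF zt]
        by (simp add: psi[of "\<psi> (inv g) z"])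
      moreover have "j (\<psi> (inv g) z) \<in> A"
        using z g zt j_psi invl AX by auto
      ultimately show "z \<in> \<psi> g ` (j -` A \<inter> space \<mu>)"
        using psi_clos[of "inv g" z] g zt by (auto simp: sp)
    next
      fix z assume "z \<in> \<psi> g ` (j -` A \<inter> space \<mu>)"
      then show "z \<in> j -` (\<phi> g ` A) \<inter> space \<mu>"
        using g psi_clos j_psi by (auto simp: sp)
    qed
    then show ?thesis
      using inv[OF g measurable_sets[OF jm A']] gA A' jm by (simp add: \<nu>_def emeasure_distr)
  qed
  moreover have "prob_space \<nu>" unfolding \<nu>_def using pm jm by (rule prob_space.prob_space_distr)
  ultimately have "invariant_borel_prob G X \<phi> \<nu>"
    by (simp add: invariant_borel_prob_def \<nu>_def)
  then show ?thesis by blast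
qed

end

theory Submission
  imports Defs
begin

text \<open>
  An invariant measure on the space of orientations of \<open>\<Gamma>\<close> with out-degrees at most \<open>k\<close>
  would give each edge a direction at random, in a way that is compatible with \<open>G\<close>. Consider
  the event that \<open>a \<rightarrow> b\<close>. By invariance its probability \<open>p\<close> is also the probability of
  \<open>a \<rightarrow> y\<close> for every \<open>y\<close> in the \<open>G\<^sub>a\<close>-orbit of \<open>b\<close>. At most \<open>k\<close> of these events
  happen at the same time, so \<open>n p \<le> k\<close> for every \<open>n\<close> up to the size of the orbit, and
  \<open>p = 0\<close> if the orbit is infinite (\<open>edge_measure_zero\<close>). By symmetry \<open>b \<rightarrow> a\<close> has
  probability zero as well, but one of the two directions must occur.

  It remains to see that these orientations form a \<open>G\<close>-flow (\<open>flow_shift\<close>). They are a closed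
  subset of the compact space \<open>2\<^sup>R\<close>, since a vertex of out-degree more than \<open>k\<close> is detected by
  \<open>k + 1\<close> edges. The action is continuous because each coordinate of the shifted orientation is
  determined by the action on two vertices, and stabilizers of vertices are open. That there
  is any orientation at all is where sparsity enters
  (\<open>simple_graph.bounded_orientations_nonempty\<close>): orienting an edge means to select one of its
  ends as its tail, no vertex may be selected more than \<open>k\<close> times, and \<open>k\<close>-sparsity is exactly
  Hall's condition for such a selection (\<open>capacitated_selection\<close>).
\<close>

section \<open>Hall's theorem with capacities\<close>

text \<open>
  Hall's marriage theorem in which every \<open>v\<close> may be chosen up to \<open>k\<close> times, for an
  arbitrary, possibly infinite, family of finite sets. The argument is Rado's: delete pairs
  from \<open>P\<close> as long as Hall's condition survives. A relation from which nothing more can be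
  deleted is single-valued on \<open>E\<close>. Indeed, if \<open>e\<close> is related to \<open>v \<noteq> w\<close>, deleting
  either pair breaks the condition on some set of indices, and since \<open>F \<mapsto> k \<cdot> card (Q `` F)\<close>
  is submodular while \<open>card\<close> is modular, the two violations together break the condition
  without any deletion. Hall's condition for a function then is the bound on its fibres.
\<close>

lemma capacitated_selection:
  fixes P :: "('e \<times> 'v) set"
  assumes fin: "\<And>e. e \<in> E \<Longrightarrow> finite (P `` {e})"
    and hall: "\<And>F. finite F \<Longrightarrow> F \<subseteq> E \<Longrightarrow> card F \<le> k * card (P `` F)"
  obtains f where "\<And>e. e \<in> E \<Longrightarrow> (e, f e) \<in> P"
    and "\<And>F v. finite F \<Longrightarrow> F \<subseteq> E \<Longrightarrow> (\<forall>e\<in>F. f e = v) \<Longrightarrow> card F \<le> k"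
proof -
  define \<D> where "\<D> = {D. \<forall>F. finite F \<longrightarrow> F \<subseteq> E \<longrightarrow> card F \<le> k * card ((P - D) `` F)}"
  \<comment> \<open>Zorn's lemma is applied to the sets of deleted pairs. The union of a chain is admissible
      because only finitely many pairs of \<open>P\<close> matter for a given finite \<open>F\<close>.\<close>
  have finF: "finite (P `` F)" if "finite F" "F \<subseteq> E" for F
  proof -
    have "P `` F = (\<Union>e\<in>F. P `` {e})" by auto
    then show ?thesis using that fin by auto
  qed
  have "\<exists>D\<in>\<D>. \<forall>D'\<in>\<D>. D \<subseteq> D' \<longrightarrow> D' = D"
  proof (rule subset_Zorn_nonempty)
    show "\<D> \<noteq> {}" using hall by (auto simp: \<D>_def intro!: exI[of _ "{}"])
    fix \<C> assume ne: "\<C> \<noteq> {}" and ch: "subset.chain \<D> \<C>"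
    show "\<Union>\<C> \<in> \<D>"
      unfolding \<D>_def
    proof (intro CollectI allI impI)
      fix F assume F: "finite F" "F \<subseteq> E"
      have "finite (P \<inter> F \<times> UNIV)"
        by (rule finite_subset[of _ "F \<times> P `` F"]) (use F finF in auto)
      then have "finite (\<Union>\<C> \<inter> (P \<inter> F \<times> UNIV))" by blast
      then obtain D where D: "D \<in> \<C>" "\<Union>\<C> \<inter> (P \<inter> F \<times> UNIV) \<subseteq> D"
        by (rule finite_subset_Union_chain[OF _ _ ne ch]) auto
      have "(P - D) `` F \<subseteq> (P - \<Union>\<C>) `` F" using D by blast
      moreover have "finite ((P - \<Union>\<C>) `` F)"
        by (rule finite_subset[OF _ finF[OF F]]) auto
      ultimately have "card ((P - D) `` F) \<le> card ((P - \<Union>\<C>) `` F)" by (simp add: card_mono)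
      moreover have "card F \<le> k * card ((P - D) `` F)"
        using D(1) ch F unfolding subset.chain_def \<D>_def by blast
      ultimately show "card F \<le> k * card ((P - \<Union>\<C>) `` F)"
        using le_trans mult_le_mono2 by blast
    qed
  qed
  then obtain D where D: "D \<in> \<D>" and max: "\<And>D'. D' \<in> \<D> \<Longrightarrow> D \<subseteq> D' \<Longrightarrow> D' = D" by blast
  define Q where "Q = P - D"
  have QP: "Q \<subseteq> P" by (auto simp: Q_def)
  have hallQ: "card F \<le> k * card (Q `` F)" if "finite F" "F \<subseteq> E" for F
    using D that by (auto simp: \<D>_def Q_def)
  have critical: "\<exists>F. finite F \<and> F \<subseteq> E \<and> e \<in> F \<and> k * card ((Q - {(e, v)}) `` F) < card F"
    if "(e, v) \<in> Q" for e v
  proof -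
    have "insert (e, v) D \<notin> \<D>" using max[of "insert (e, v) D"] that by (auto simp: Q_def)
    moreover have "P - insert (e, v) D = Q - {(e, v)}" by (auto simp: Q_def)
    ultimately obtain F where F: "finite F" "F \<subseteq> E" "k * card ((Q - {(e, v)}) `` F) < card F"
      by (auto simp: \<D>_def not_le)
    have "e \<in> F"
    proof (rule ccontr)
      assume "e \<notin> F"
      then have "(Q - {(e, v)}) `` F = Q `` F" by blast
      then show False using hallQ[OF F(1,2)] F(3) by simp
    qed
    then show ?thesis using F by blast
  qed
  have unique: "v = w" if ev: "(e, v) \<in> Q" and ew: "(e, w) \<in> Q" for e v w
  proof (rule ccontr)
    assume "v \<noteq> w"
    obtain F1 where F1: "finite F1" "F1 \<subseteq> E" "e \<in> F1" "k * card ((Q - {(e, v)}) `` F1) < card F1"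
      using critical[OF ev] by blast
    obtain F2 where F2: "finite F2" "F2 \<subseteq> E" "e \<in> F2" "k * card ((Q - {(e, w)}) `` F2) < card F2"
      using critical[OF ew] by blast
    define U1 U2 where "U1 = (Q - {(e, v)}) `` F1" and "U2 = (Q - {(e, w)}) `` F2"
    have "U1 \<subseteq> P `` F1" "U2 \<subseteq> P `` F2" using QP by (auto simp: U1_def U2_def)
    then have fU: "finite U1" "finite U2"
      using finF[OF F1(1,2)] finF[OF F2(1,2)] finite_subset by blast+
    \<comment> \<open>Each of \<open>v\<close> and \<open>w\<close> is missing from the image of \<open>e\<close> on one side only, so the
        union sees all of \<open>Q\<close>. In the intersection both may be missing, hence \<open>e\<close> is left out
        there. The loss of one element is outweighed by the two strict inequalities.\<close>
    have "Q `` (F1 \<union> F2) \<subseteq> U1 \<union> U2"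
      using \<open>v \<noteq> w\<close> F1(3) F2(3) by (auto simp: U1_def U2_def)
    then have "card (Q `` (F1 \<union> F2)) \<le> card (U1 \<union> U2)" using fU by (simp add: card_mono)
    then have join: "card (F1 \<union> F2) \<le> k * card (U1 \<union> U2)"
      using hallQ[of "F1 \<union> F2"] F1 F2 by (meson finite_UnI le_trans mult_le_mono2 Un_least)
    have "Q `` (F1 \<inter> F2 - {e}) \<subseteq> U1 \<inter> U2" by (auto simp: U1_def U2_def)
    then have "card (Q `` (F1 \<inter> F2 - {e})) \<le> card (U1 \<inter> U2)" using fU by (simp add: card_mono)
    moreover have "card (F1 \<inter> F2 - {e}) \<le> k * card (Q `` (F1 \<inter> F2 - {e}))"
      using F1 by (intro hallQ) auto
    ultimately have meet: "card (F1 \<inter> F2 - {e}) \<le> k * card (U1 \<inter> U2)"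
      by (meson le_trans mult_le_mono2)
    have "card (F1 \<inter> F2) \<le> Suc (card (F1 \<inter> F2 - {e}))"
      using F1 F2 by (simp add: card_Suc_Diff1)
    moreover have "k * card U1 + k * card U2 = k * card (U1 \<union> U2) + k * card (U1 \<inter> U2)"
      using card_Un_Int[OF fU] by (simp flip: add_mult_distrib2)
    moreover have "card F1 + card F2 = card (F1 \<union> F2) + card (F1 \<inter> F2)"
      using card_Un_Int F1 F2 by blast
    ultimately show False
      using join meet F1(4) F2(4) unfolding U1_def[symmetric] U2_def[symmetric] by linarith
  qed
  have "\<exists>v. (e, v) \<in> Q" if "e \<in> E" for e
  proof (rule ccontr)
    assume "\<nexists>v. (e, v) \<in> Q"
    then have "Q `` {e} = {}" by blast
    then show False using hallQ[of "{e}"] that by simp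
  qed
  then obtain f where f: "\<And>e. e \<in> E \<Longrightarrow> (e, f e) \<in> Q" by metis
  show thesis
  proof (rule that)
    show "(e, f e) \<in> P" if "e \<in> E" for e using f[OF that] QP by blast
    show "card F \<le> k" if F: "finite F" "F \<subseteq> E" "\<forall>e\<in>F. f e = v" for F v
    proof -
      have "Q `` F \<subseteq> {v}" using F f unique by blast
      then have "card (Q `` F) \<le> 1" using card_mono[of "{v}"] by simp
      then have "k * card (Q `` F) \<le> k * 1" by (rule mult_le_mono2)
      then show ?thesis using hallQ[OF F(1,2)] by linarith
    qed
  qed
qed

section \<open>The compact space of orientations with bounded out-degree\<close>

text \<open>
  \<open>\<omega> (x, y)\<close> means that \<open>x \<rightarrow> y\<close> is an arc. An edge may carry both directions, so
  that \<open>x \<rightarrow> y\<close> and \<open>y \<rightarrow> x\<close> are events that cover the space. Bounding the finite sets of out-neighbours also forces the whole set of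
  out-neighbours to be finite, which a bound on its \<open>card\<close> would not.
\<close>

definition bounded_orientations :: "nat \<Rightarrow> ('m \<times> 'm) set \<Rightarrow> ('m \<times> 'm \<Rightarrow> bool) set"
  where "bounded_orientations k R = {\<omega> \<in> R \<rightarrow>\<^sub>E UNIV.
    (\<forall>(x, y)\<in>R. \<omega> (x, y) \<or> \<omega> (y, x)) \<and>
    (\<forall>x S. finite S \<and> S \<subseteq> R `` {x} \<and> (\<forall>y\<in>S. \<omega> (x, y)) \<longrightarrow> card S \<le> k)}"

definition orientation_space :: "nat \<Rightarrow> ('m \<times> 'm) set \<Rightarrow> ('m \<times> 'm \<Rightarrow> bool) topology"
  where "orientation_space k R =
    subtopology (product_topology (\<lambda>_. discrete_topology UNIV) R) (bounded_orientations k R)"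

lemma topspace_orientation_space [simp]:
  "topspace (orientation_space k R) = bounded_orientations k R"
proof -
  have "bounded_orientations k R \<subseteq> R \<rightarrow>\<^sub>E UNIV" unfolding bounded_orientations_def by blast
  then show ?thesis by (simp add: orientation_space_def Int_absorb1)
qed

lemma continuous_map_orientation_coordinate:
  assumes "e \<in> R"
  shows "continuous_map (orientation_space k R) (discrete_topology UNIV) (\<lambda>\<omega>. \<omega> e)"
  unfolding orientation_space_def
  using assms by (intro continuous_map_from_subtopology continuous_map_product_projection)

lemma openin_orientation_cylinder:
  assumes "e \<in> R"
  shows "openin (orientation_space k R) {\<omega> \<in> bounded_orientations k R. \<omega> e \<in> B}"
  using openin_continuous_map_preimage[OF continuous_map_orientation_coordinate[OF assms], of B]
  by simp

lemma sets_orientation_cylinder: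
  assumes "e \<in> R" "sets \<mu> = sets (borel_of (orientation_space k R))"
  shows "{\<omega> \<in> bounded_orientations k R. \<omega> e} \<in> sets \<mu>"
proof -
  have "openin (orientation_space k R) {\<omega> \<in> bounded_orientations k R. \<omega> e}"
    using openin_orientation_cylinder[OF assms(1), of k "{True}"] by simp
  then show ?thesis unfolding assms(2) sets_borel_of by (intro sigma_sets.Basic) simp
qed

lemma Hausdorff_orientation_space: "Hausdorff_space (orientation_space k R)"
  unfolding orientation_space_def
  by (intro Hausdorff_space_subtopology) (simp add: Hausdorff_space_product_topology)

text \<open>
  The orientations are cut out of \<open>2\<^sup>R\<close> by conditions that involve finitely many coordinates
  each: \<open>A e\<close> says that the edge \<open>e\<close> has a direction, and \<open>B (x, S)\<close> that a set \<open>S\<close> of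
  more than \<open>k\<close> neighbours of \<open>x\<close> is not entirely made of out-neighbours.
\<close>

lemma compact_orientation_space:
  assumes "sym R"
  shows "compact_space (orientation_space k R)"
proof -
  let ?C = "product_topology (\<lambda>_. discrete_topology (UNIV :: bool set)) R"
  have cyl: "closedin ?C {\<omega> \<in> R \<rightarrow>\<^sub>E UNIV. \<omega> e = b}" if "e \<in> R" for e b
    using closedin_continuous_map_preimage[OF
        continuous_map_product_projection[OF that, of "\<lambda>_. discrete_topology UNIV"], of "{b}"]
    by simp
  define A where "A e = {\<omega> \<in> R \<rightarrow>\<^sub>E UNIV. \<omega> e = True} \<union> {\<omega> \<in> R \<rightarrow>\<^sub>E UNIV. \<omega> (prod.swap e) = True}" for e
  define B where "B p = (\<Union>y\<in>snd p. {\<omega> \<in> R \<rightarrow>\<^sub>E UNIV. \<omega> (fst p, y) = False})" for p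
  define J where "J = {(x, S). finite S \<and> S \<subseteq> R `` {x} \<and> k < card S}"
  have "closedin ?C (A e)" if "e \<in> R" for e
    unfolding A_def using that assms by (intro closedin_Un cyl) (auto simp: sym_def prod.swap_def)
  moreover have "closedin ?C (B p)" if "p \<in> J" for p
    unfolding B_def
  proof (rule closedin_Union)
    show "finite ((\<lambda>y. {\<omega> \<in> R \<rightarrow>\<^sub>E UNIV. \<omega> (fst p, y) = False}) ` snd p)"
      using that by (auto simp: J_def)
    fix K assume "K \<in> (\<lambda>y. {\<omega> \<in> R \<rightarrow>\<^sub>E UNIV. \<omega> (fst p, y) = False}) ` snd p"
    then obtain y where "y \<in> snd p" "K = {\<omega> \<in> R \<rightarrow>\<^sub>E UNIV. \<omega> (fst p, y) = False}" by blast
    moreover from this have "(fst p, y) \<in> R" using that by (auto simp: J_def)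
    ultimately show "closedin ?C K" using cyl[of "(fst p, y)" False] by simp
  qed
  ultimately have "closedin ?C (\<Inter>(insert (topspace ?C) (A ` R \<union> B ` J)))"
    using closedin_topspace[of ?C] by (intro closedin_Inter) blast+
  also have "\<Inter>(insert (topspace ?C) (A ` R \<union> B ` J)) = bounded_orientations k R"
  proof (intro equalityI subsetI)
    fix \<omega> assume \<omega>: "\<omega> \<in> \<Inter>(insert (topspace ?C) (A ` R \<union> B ` J))"
    have "card S \<le> k" if "finite S" "S \<subseteq> R `` {x}" "\<forall>y\<in>S. \<omega> (x, y)" for x S
    proof (rule ccontr)
      assume "\<not> card S \<le> k"
      then have "(x, S) \<in> J" using that by (simp add: J_def)
      then have "\<omega> \<in> B (x, S)" using \<omega> by blast
      then show False using that by (auto simp: B_def)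
    qed
    moreover have "\<omega> (x, y) \<or> \<omega> (y, x)" if "(x, y) \<in> R" for x y
    proof -
      have "\<omega> \<in> A (x, y)" using \<omega> that by blast
      then show ?thesis by (auto simp: A_def)
    qed
    ultimately show "\<omega> \<in> bounded_orientations k R"
      using \<omega> by (auto simp: bounded_orientations_def)
  next
    fix \<omega> assume \<omega>: "\<omega> \<in> bounded_orientations k R"
    then have e: "\<omega> \<in> R \<rightarrow>\<^sub>E UNIV" by (simp add: bounded_orientations_def)
    have "\<omega> \<in> A e" if "e \<in> R" for e
      using \<omega> that e by (cases e) (auto simp: bounded_orientations_def A_def)
    moreover have "\<omega> \<in> B p" if "p \<in> J" for p
    proof (rule ccontr)
      assume "\<omega> \<notin> B p"
      then have "\<forall>y\<in>snd p. \<omega> (fst p, y)" using e by (auto simp: B_def)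
      then have "card (snd p) \<le> k"
        using \<omega> that by (auto simp: J_def bounded_orientations_def)
      then show False using that by (auto simp: J_def)
    qed
    ultimately show "\<omega> \<in> \<Inter>(insert (topspace ?C) (A ` R \<union> B ` J))" using e by auto
  qed
  finally have "closedin ?C (bounded_orientations k R)" .
  moreover have "compact_space ?C"
    by (simp add: compact_space_product_topology compact_space_discrete_topology)
  ultimately show ?thesis
    unfolding orientation_space_def
    using closedin_compact_space compact_space_subtopology by blast
qed

text \<open>
  Selecting a tail for each edge with capacity \<open>k\<close>: a finite set \<open>F\<close> of edges lies in the
  subgraph induced on \<open>\<Union>F\<close>, so sparsity gives Hall's condition.
\<close>

lemma (in simple_graph) bounded_orientations_nonempty:
  assumes "k_sparse k M R"
  shows "bounded_orientations k R \<noteq> {}"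
proof -
  define E where "E = {{x, y} |x y. (x, y) \<in> R}"
  define P where "P = {(e, v). e \<in> E \<and> v \<in> e}"
  have finE: "finite e" if "e \<in> E" for e using that by (auto simp: E_def)
  have "finite (P `` {e})" if "e \<in> E" for e
    by (rule finite_subset[OF _ finE[OF that]]) (auto simp: P_def)
  moreover have "card F \<le> k * card (P `` F)" if F: "finite F" "F \<subseteq> E" for F
  proof -
    have PF: "P `` F = \<Union>F" using F by (auto simp: P_def)
    have fin: "finite (\<Union>F)" using F finE by auto
    have sub: "\<Union>F \<subseteq> M" using F rel by (fastforce simp: E_def)
    have "F \<subseteq> induced_edges R (\<Union>F)"
    proof
      fix e assume e: "e \<in> F"
      then obtain x y where "e = {x, y}" "(x, y) \<in> R" using F by (auto simp: E_def)
      then show "e \<in> induced_edges R (\<Union>F)" using e unfolding induced_edges_def by blast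
    qed
    moreover have "finite (induced_edges R (\<Union>F))"
      by (rule finite_subset[of _ "Pow (\<Union>F)"]) (use fin in \<open>auto simp: induced_edges_def\<close>)
    ultimately have "card F \<le> card (induced_edges R (\<Union>F))" by (simp add: card_mono)
    also have "\<dots> \<le> k * card (\<Union>F)" using assms fin sub by (auto simp: k_sparse_def)
    finally show ?thesis using PF by simp
  qed
  ultimately obtain f where f: "\<And>e. e \<in> E \<Longrightarrow> (e, f e) \<in> P"
    and fib: "\<And>F v. finite F \<Longrightarrow> F \<subseteq> E \<Longrightarrow> (\<forall>e\<in>F. f e = v) \<Longrightarrow> card F \<le> k"
    using capacitated_selection[of E P k] by blast
  define \<omega> where "\<omega> = restrict (\<lambda>(x, y). f {x, y} = x) R"
  have "\<omega> (x, y) \<or> \<omega> (y, x)" if xy: "(x, y) \<in> R" for x y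
  proof -
    have "{x, y} \<in> E" using xy by (auto simp: E_def)
    then have "f {x, y} \<in> {x, y}" using f by (auto simp: P_def)
    moreover have "(y, x) \<in> R" using xy symmetric by (rule symD[rotated])
    ultimately show ?thesis using xy by (auto simp: \<omega>_def insert_commute)
  qed
  moreover have "card S \<le> k" if S: "finite S" "S \<subseteq> R `` {x}" "\<forall>y\<in>S. \<omega> (x, y)" for x S
  proof -
    have "card ((\<lambda>y. {x, y}) ` S) \<le> k"
    proof (rule fib)
      show "(\<lambda>y. {x, y}) ` S \<subseteq> E" using S by (auto simp: E_def)
      show "\<forall>e\<in>(\<lambda>y. {x, y}) ` S. f e = x" using S by (auto simp: \<omega>_def)
    qed (use S in simp)
    moreover have "inj_on (\<lambda>y. {x, y}) S" by (auto simp: inj_on_def doubleton_eq_iff)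
    ultimately show ?thesis by (simp add: card_image)
  qed
  moreover have "\<omega> \<in> R \<rightarrow>\<^sub>E UNIV" by (auto simp: \<omega>_def)
  ultimately have "\<omega> \<in> bounded_orientations k R"
    unfolding bounded_orientations_def by blast
  then show ?thesis by blast
qed

section \<open>The flow of orientations\<close>

locale continuous_graph_action = simple_graph M R + topological_group G T
  for M :: "'m set" and R and G :: "('a, 'c) monoid_scheme" (structure) and T +
  fixes \<phi> :: "'a \<Rightarrow> 'm \<Rightarrow> 'm"
  assumes acts: "acts_continuously_on_graph G T M R \<phi>"
begin

sublocale group_action G M \<phi>
  using acts by (simp add: acts_continuously_on_graph_def continuous_action_def)

lemma edge_image:
  assumes "g \<in> carrier G" "(x, y) \<in> R"
  shows "(\<phi> g x, \<phi> g y) \<in> R"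
proof -
  have "x \<in> M" "y \<in> M" using assms rel by auto
  then show ?thesis using acts assms unfolding acts_continuously_on_graph_def by blast
qed

lemma inv_cancel: "g \<in> carrier G \<Longrightarrow> x \<in> M \<Longrightarrow> \<phi> (inv g) (\<phi> g x) = x"
  by (rule orbit_sym_aux[OF _ _ refl])

lemma inv_cancel': "g \<in> carrier G \<Longrightarrow> x \<in> M \<Longrightarrow> \<phi> g (\<phi> (inv g) x) = x"
  using inv_cancel[of "inv g" x] by simp

definition shift :: "'a \<Rightarrow> ('m \<times> 'm \<Rightarrow> bool) \<Rightarrow> 'm \<times> 'm \<Rightarrow> bool"
  where "shift g \<omega> = restrict (\<lambda>(x, y). \<omega> (\<phi> (inv g) x, \<phi> (inv g) y)) R"

lemma shift_apply: "(x, y) \<in> R \<Longrightarrow> shift g \<omega> (x, y) = \<omega> (\<phi> (inv g) x, \<phi> (inv g) y)"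
  by (simp add: shift_def)

lemma shift_bounded_orientation:
  assumes g: "g \<in> carrier G" and \<omega>: "\<omega> \<in> bounded_orientations k R"
  shows "shift g \<omega> \<in> bounded_orientations k R"
proof -
  have "shift g \<omega> (x, y) \<or> shift g \<omega> (y, x)" if "(x, y) \<in> R" for x y
  proof -
    have "(\<phi> (inv g) x, \<phi> (inv g) y) \<in> R" using edge_image that g by simp
    then have "\<omega> (\<phi> (inv g) x, \<phi> (inv g) y) \<or> \<omega> (\<phi> (inv g) y, \<phi> (inv g) x)"
      using \<omega> unfolding bounded_orientations_def by blast
    then show ?thesis using shift_apply that symD[OF symmetric that] by blast
  qed
  moreover have "card S \<le> k" if S: "finite S" "S \<subseteq> R `` {x}" "\<forall>y\<in>S. shift g \<omega> (x, y)" for x S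
  proof -
    have "card (\<phi> (inv g) ` S) \<le> k"
    proof -
      have "\<phi> (inv g) ` S \<subseteq> R `` {\<phi> (inv g) x}" using S g edge_image by auto
      moreover have "\<forall>y\<in>\<phi> (inv g) ` S. \<omega> (\<phi> (inv g) x, y)" using S shift_apply by blast
      moreover have "finite (\<phi> (inv g) ` S)" using S(1) by simp
      ultimately show ?thesis using \<omega> unfolding bounded_orientations_def by blast
    qed
    moreover have "inj_on (\<phi> (inv g)) S"
    proof (rule inj_on_inverseI)
      fix y assume "y \<in> S"
      then show "\<phi> g (\<phi> (inv g) y) = y" using S rel g by (intro inv_cancel') auto
    qed
    ultimately show ?thesis by (simp add: card_image)
  qed
  moreover have "shift g \<omega> \<in> R \<rightarrow>\<^sub>E UNIV" by (auto simp: shift_def)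
  ultimately show ?thesis unfolding bounded_orientations_def by blast
qed

lemma shift_one:
  assumes "\<omega> \<in> bounded_orientations k R"
  shows "shift \<one> \<omega> = \<omega>"
proof (rule extensionalityI[of _ R])
  have one: "\<phi> \<one> x = x" if "x \<in> M" for x
    using that id_eq_one by (metis restrict_apply')
  show "shift \<one> \<omega> e = \<omega> e" if "e \<in> R" for e
    using that rel by (cases e) (auto simp: shift_def one)
qed (use assms in \<open>auto simp: shift_def bounded_orientations_def PiE_def\<close>)

lemma shift_mult:
  assumes gh: "g \<in> carrier G" "h \<in> carrier G"
  shows "shift (g \<otimes> h) \<omega> = shift g (shift h \<omega>)"
proof
  fix e :: "'m \<times> 'm"
  obtain x y where e: "e = (x, y)" by (cases e)
  show "shift (g \<otimes> h) \<omega> e = shift g (shift h \<omega>) e"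
  proof (cases "e \<in> R")
    case True
    then have "(\<phi> (inv g) x, \<phi> (inv g) y) \<in> R" "x \<in> M" "y \<in> M"
      using e gh edge_image rel by auto
    then show ?thesis
      using True e gh by (simp add: shift_apply inv_mult_group composition_rule)
  qed (simp add: shift_def)
qed

text \<open>
  It suffices to consider one coordinate \<open>(x, y)\<close>. Its value at the shifted orientation is
  that of \<open>\<omega>\<close> at \<open>p = (g\<inverse> x, g\<inverse> y)\<close>. Cutting the product into the open pieces \<open>W p\<close> on
  which \<open>p\<close> is constant turns this into a coordinate of \<open>\<omega>\<close>.
\<close>

lemma continuous_map_shift:
  "continuous_map (prod_topology T (orientation_space k R)) (orientation_space k R)
     (\<lambda>(g, \<omega>). shift g \<omega>)"
proof -
  let ?X = "orientation_space k R"
  have orb: "openin T {g \<in> carrier G. \<phi> (inv g) x = u}" if "x \<in> M" "u \<in> M" for x u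
  proof -
    have "continuous_map T (prod_topology T (discrete_topology M)) (\<lambda>g. (inv g, x))"
      using continuous_inv that by (simp add: continuous_map_pairwise o_def)
    then have "continuous_map T (discrete_topology M) ((\<lambda>(g, x). \<phi> g x) \<circ> (\<lambda>g. (inv g, x)))"
      using acts continuous_map_compose
      unfolding acts_continuously_on_graph_def continuous_action_def by blast
    from openin_continuous_map_preimage[OF this, of "{u}"] that show ?thesis
      by (simp add: topspace_eq_carrier)
  qed
  have coord: "continuous_map (prod_topology T ?X) (discrete_topology UNIV)
      (\<lambda>p. shift (fst p) (snd p) (x, y))" if xy: "(x, y) \<in> R" for x y
    unfolding continuous_map
  proof (intro conjI allI impI)
    fix B :: "bool set"
    have xyM: "x \<in> M" "y \<in> M" using xy rel by auto
    define W where "W p = ({g \<in> carrier G. \<phi> (inv g) x = fst p} \<inter> {g \<in> carrier G. \<phi> (inv g) y = snd p})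
      \<times> {\<omega> \<in> bounded_orientations k R. \<omega> p \<in> B}" for p
    have "openin (prod_topology T ?X) (W p)" if "p \<in> R" for p
      unfolding W_def using that rel xyM
      by (intro openin_prod_Times_iff[THEN iffD2] disjI2 conjI openin_Int orb
          openin_orientation_cylinder) auto
    then have "openin (prod_topology T ?X) (\<Union>p\<in>R. W p)" by blast
    also have "(\<Union>p\<in>R. W p)
        = {p \<in> topspace (prod_topology T ?X). shift (fst p) (snd p) (x, y) \<in> B}"
      using xy edge_image[of "inv _"]
      by (force simp: W_def shift_apply topspace_eq_carrier)
    finally show "openin (prod_topology T ?X)
      {p \<in> topspace (prod_topology T ?X). shift (fst p) (snd p) (x, y) \<in> B}" .
  qed simp
  have "continuous_map (prod_topology T ?X) (product_topology (\<lambda>_. discrete_topology UNIV) R)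
      (\<lambda>p. shift (fst p) (snd p))"
    unfolding continuous_map_componentwise using coord by (auto simp: shift_def)
  moreover have "(\<lambda>p. shift (fst p) (snd p)) \<in> topspace (prod_topology T ?X) \<rightarrow> bounded_orientations k R"
    by (auto simp: topspace_eq_carrier shift_bounded_orientation)
  ultimately have "continuous_map (prod_topology T ?X)
      (subtopology (product_topology (\<lambda>_. discrete_topology UNIV) R) (bounded_orientations k R))
      (\<lambda>p. shift (fst p) (snd p))"
    by (auto simp: continuous_map_in_subtopology)
  then show ?thesis by (simp only: orientation_space_def[symmetric] case_prod_unfold)
qed

text \<open>
  The restriction only serves to make the maps extensional, as \<open>group_action\<close> requires.
\<close>

lemma flow_shift:
  assumes "k_sparse k M R"
  shows "flow G T (orientation_space k R) (\<lambda>g. restrict (shift g) (bounded_orientations k R))"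
proof -
  let ?B = "bounded_orientations k R"
  have "group_action G ?B (\<lambda>g. restrict (shift g) ?B)"
  proof (rule group_actionI)
    show "group G" by (rule is_group)
    show "restrict (shift g) ?B \<omega> \<in> ?B" if "g \<in> carrier G" "\<omega> \<in> ?B" for g \<omega>
      using that by (simp add: shift_bounded_orientation)
    show "restrict (shift \<one>) ?B \<omega> = \<omega>" if "\<omega> \<in> ?B" for \<omega>
      using that by (simp add: shift_one)
    show "restrict (shift (g \<otimes> h)) ?B \<omega> = restrict (shift g) ?B (restrict (shift h) ?B \<omega>)"
      if "g \<in> carrier G" "h \<in> carrier G" "\<omega> \<in> ?B" for g h \<omega>
      using that by (simp add: shift_bounded_orientation shift_mult)
  qed simp
  moreover have "continuous_map (prod_topology T (orientation_space k R)) (orientation_space k R)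
      (\<lambda>(g, \<omega>). restrict (shift g) ?B \<omega>)"
    by (rule continuous_map_eq[OF continuous_map_shift]) auto
  ultimately show ?thesis
    using bounded_orientations_nonempty[OF assms] compact_orientation_space[OF symmetric]
      Hausdorff_orientation_space
    by (auto simp: flow_def continuous_action_def)
qed

section \<open>Invariant measures avoid edges with an infinite orbit\<close>

text \<open>
  The events \<open>a \<rightarrow> y\<close>, with \<open>y\<close> in the orbit of \<open>b\<close> under the stabilizer of \<open>a\<close>, are
  translates of one another and have the same measure. For any \<open>n\<close> of them, the expected number
  of those that happen is at most \<open>k\<close>.
\<close>

lemma edge_measure_zero:
  assumes \<mu>: "invariant_borel_prob G (orientation_space k R)
      (\<lambda>g. restrict (shift g) (bounded_orientations k R)) \<mu>"
    and ab: "(a, b) \<in> R"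
    and inf: "infinite (orbit (G\<lparr>carrier := stabilizer G \<phi> a\<rparr>) \<phi> b)"
  shows "measure \<mu> {\<omega> \<in> bounded_orientations k R. \<omega> (a, b)} = 0"
proof -
  let ?B = "bounded_orientations k R"
  define A where "A y = {\<omega> \<in> ?B. \<omega> (a, y)}" for y
  interpret prob_space \<mu> using \<mu> by (simp add: invariant_borel_prob_def)
  have sp: "space \<mu> = ?B" and se: "sets \<mu> = sets (borel_of (orientation_space k R))"
    using \<mu> by (auto simp: invariant_borel_prob_def)
  have A: "A y \<in> sets \<mu>" if "(a, y) \<in> R" for y
    unfolding A_def using that se by (rule sets_orientation_cylinder)
  have invar: "emeasure \<mu> (restrict (shift g) ?B ` C) = emeasure \<mu> C"
    if "g \<in> carrier G" "C \<in> sets \<mu>" for g C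
    using \<mu> that unfolding invariant_borel_prob_def by blast
  define Y where "Y = {\<phi> g b |g. g \<in> carrier G \<and> \<phi> g a = a}"
  have "infinite Y"
    using inf by (simp add: orbit_def stabilizer_def Y_def)
  have abM: "a \<in> M" "b \<in> M" using ab rel by auto
  have Y: "(a, y) \<in> R \<and> measure \<mu> (A y) = measure \<mu> (A b)" if "y \<in> Y" for y
  proof -
    obtain g where g: "g \<in> carrier G" "\<phi> g a = a" "y = \<phi> g b" using \<open>y \<in> Y\<close> by (auto simp: Y_def)
    have ay: "(a, y) \<in> R" using edge_image[OF g(1) ab] g by simp
    have invs: "\<phi> (inv g) a = a" "\<phi> (inv g) y = b"
      using inv_cancel[OF g(1)] abM g by metis+
    have "shift g ` A b = A y"
    proof (intro equalityI subsetI)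
      fix \<omega> assume "\<omega> \<in> shift g ` A b"
      then show "\<omega> \<in> A y"
        using g ay invs by (auto simp: A_def shift_bounded_orientation shift_apply)
    next
      fix \<omega> assume \<omega>: "\<omega> \<in> A y"
      then have "shift g (shift (inv g) \<omega>) = \<omega>"
        using g(1) shift_one[of \<omega> k] by (simp add: A_def flip: shift_mult)
      moreover have "shift (inv g) \<omega> \<in> A b"
        using \<omega> g ab shift_bounded_orientation[of "inv g" \<omega> k]
        by (simp add: A_def shift_apply)
      ultimately show "\<omega> \<in> shift g ` A b" by force
    qed
    moreover have "restrict (shift g) ?B ` A b = shift g ` A b"
      by (rule image_cong) (auto simp: A_def)
    ultimately have "emeasure \<mu> (A y) = emeasure \<mu> (A b)"
      using invar[OF g(1) A[OF ab]] by simp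
    then show ?thesis using ay by (simp add: measure_def)
  qed
  have bound: "real n * measure \<mu> (A b) \<le> real k" for n
  proof -
    obtain S where S: "S \<subseteq> Y" "finite S" "card S = n"
      using infinite_arbitrarily_large[OF \<open>infinite Y\<close>] by blast
    have AS: "A y \<in> sets \<mu>" if "y \<in> S" for y using A Y S(1) that by blast
    have int: "integrable \<mu> (indicator (A y) :: _ \<Rightarrow> real)" if "y \<in> S" for y
      by (rule integrable_real_indicator[OF AS[OF that]]) (simp add: emeasure_eq_measure)
    have "real n * measure \<mu> (A b) = (\<Sum>y\<in>S. measure \<mu> (A b))" using S(3) by simp
    also have "\<dots> = (\<Sum>y\<in>S. \<integral>\<omega>. indicator (A y) \<omega> \<partial>\<mu>)"
    proof (rule sum.cong)
      fix y assume y: "y \<in> S"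
      then have "measure \<mu> (A b) = measure \<mu> (A y)" using Y S(1) by auto
      also have "\<dots> = (\<integral>\<omega>. indicator (A y) \<omega> \<partial>\<mu>)"
        using sets.sets_into_space[OF AS[OF y]] by (simp add: Int_absorb2)
      finally show "measure \<mu> (A b) = (\<integral>\<omega>. indicator (A y) \<omega> \<partial>\<mu>)" .
    qed simp
    also have "\<dots> = (\<integral>\<omega>. (\<Sum>y\<in>S. indicator (A y) \<omega>) \<partial>\<mu>)"
      by (rule Bochner_Integration.integral_sum[symmetric]) (rule int)
    also have "\<dots> \<le> (\<integral>\<omega>. real k \<partial>\<mu>)"
    proof (rule integral_mono)
      show "integrable \<mu> (\<lambda>\<omega>. \<Sum>y\<in>S. indicator (A y) \<omega> :: real)"
        by (rule Bochner_Integration.integrable_sum) (rule int)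
      fix \<omega> assume "\<omega> \<in> space \<mu>"
      then have \<omega>: "\<omega> \<in> ?B" by (simp add: sp)
      have "(\<Sum>y\<in>S. indicator (A y) \<omega> :: real) = real (card {y \<in> S. \<omega> (a, y)})"
        using S(2) \<omega> by (simp add: A_def indicator_def sum.If_cases Int_def)
      moreover have "card {y \<in> S. \<omega> (a, y)} \<le> k"
      proof -
        have "finite {y \<in> S. \<omega> (a, y)}" "{y \<in> S. \<omega> (a, y)} \<subseteq> R `` {a}"
          using S(1,2) Y by auto
        then show ?thesis using \<omega> unfolding bounded_orientations_def by blast
      qed
      ultimately show "(\<Sum>y\<in>S. indicator (A y) \<omega>) \<le> real k" by simp
    qed simp
    finally show ?thesis by (simp add: prob_space)
  qed
  have "measure \<mu> (A b) = 0"
  proof (rule ccontr)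
    assume "measure \<mu> (A b) \<noteq> 0"
    then have pos: "0 < measure \<mu> (A b)" by (simp add: zero_less_measure_iff)
    obtain n where "real k < real n * measure \<mu> (A b)"
      using reals_Archimedean3[OF pos] by blast
    then show False using bound[of n] by simp
  qed
  then show ?thesis by (simp add: A_def)
qed

end

theorem theorem3p8:
  fixes k :: nat
    and M :: "'m set" and R :: "('m \<times> 'm) set"
    and G :: "('a, 'c) monoid_scheme" and T :: "'a topology"
    and \<phi> :: "'a \<Rightarrow> 'm \<Rightarrow> 'm"
    and a b :: 'm
  assumes "simple_graph M R"
    and "k_sparse k M R"
    and "topological_group G T"
    and "acts_continuously_on_graph G T M R \<phi>"
    and "(a, b) \<in> R"
    and "infinite (orbit (G\<lparr>carrier := stabilizer G \<phi> a\<rparr>) \<phi> b)"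
    and "infinite (orbit (G\<lparr>carrier := stabilizer G \<phi> b\<rparr>) \<phi> a)"
  shows "\<not> amenable G T"
proof
  assume am: "amenable G T"
  interpret continuous_graph_action M R G T \<phi>
    using assms by (simp add: continuous_graph_action_def continuous_graph_action_axioms_def)
  let ?B = "bounded_orientations k R"
  obtain \<mu> where \<mu>: "invariant_borel_prob G (orientation_space k R)
      (\<lambda>g. restrict (shift g) ?B) \<mu>"
    using amenable_imp_invariant_measure[OF assms(3) am flow_shift[OF assms(2)]] by blast
  have ba: "(b, a) \<in> R" using symD[OF symmetric assms(5)] .
  interpret prob_space \<mu> using \<mu> by (simp add: invariant_borel_prob_def)
  have sp: "space \<mu> = ?B" and se: "sets \<mu> = sets (borel_of (orientation_space k R))"
    using \<mu> by (auto simp: invariant_borel_prob_def)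
  have meas: "{\<omega> \<in> ?B. \<omega> e} \<in> sets \<mu>" if "e \<in> R" for e
    using that se by (rule sets_orientation_cylinder)
  have "1 = measure \<mu> ({\<omega> \<in> ?B. \<omega> (a, b)} \<union> {\<omega> \<in> ?B. \<omega> (b, a)})"
  proof -
    have "{\<omega> \<in> ?B. \<omega> (a, b)} \<union> {\<omega> \<in> ?B. \<omega> (b, a)} = space \<mu>"
      using assms(5) by (auto simp: sp bounded_orientations_def)
    then show ?thesis by (simp add: prob_space)
  qed
  also have "\<dots> \<le> measure \<mu> {\<omega> \<in> ?B. \<omega> (a, b)} + measure \<mu> {\<omega> \<in> ?B. \<omega> (b, a)}"
    by (intro measure_Un_le meas assms(5) ba)
  also have "\<dots> = 0"
    using edge_measure_zero[OF \<mu>] assms(5-7) ba by simp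
  finally show False by simp
qed

end
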